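(* Let $T_t$ be the wave propagator in dimension $d=3$, and $g(u)=e^{-\pi|u|^2}$, $u\in\mathbb{R}^3$. Then, for all $t>0$ and all $z=(x,\xi)$, $w=(y,\eta)\in\mathbb{R}^6$, $$|\langle T_t\pi(z)g,\pi(w)g\rangle|\le t\,\exp\left(-\tfrac\pi2(|x-y|-t)^2\right)\exp\left(-\tfrac\pi2|\xi-\eta|^2\right).$$
   Context: $T_t$ is the Fourier multiplier on $\mathbb{R}^3$ with symbol $\frac{\sin(2\pi|\xi|t)}{2\pi|\xi|}$ with respect to $\widehat f(\xi)=\int f(x)e^{-2\pi i x\cdot\xi}dx$; equivalently $T_tf=f*\mu_t$ with $d\mu_t=(4\pi t)^{-1}d\sigma_{\partial B_t(0)}$ (surface measure on the sphere of radius $t$). Time-frequency shifts: $\pi(x,\xi)f(u)=e^{2\pi i\xi\cdot u}f(u-x)$. $\langle\cdot,\cdot\rangle$ is the $L^2(\mathbb{R}^3)$ inner product. *)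

theory Defs
  imports "HOL-Analysis.Analysis"
begin

definition fourier :: "('a::euclidean_space \<Rightarrow> complex) \<Rightarrow> 'a \<Rightarrow> complex" where
  "fourier f \<xi> = (LINT x|lborel. f x * cis (- 2 * pi * (x \<bullet> \<xi>)))"

definition inv_fourier :: "('a::euclidean_space \<Rightarrow> complex) \<Rightarrow> 'a \<Rightarrow> complex" where
  "inv_fourier h x = (LINT \<xi>|lborel. h \<xi> * cis (2 * pi * (x \<bullet> \<xi>)))"

text \<open>The integral formulas give the Fourier multiplier pointwise for functions \<open>f\<close> such that
  \<open>f\<close> and \<open>\<lambda>\<xi>. m \<xi> * fourier f \<xi>\<close> are integrable, in particular for Schwartz functions and a bounded
  measurable symbol \<open>m\<close>; the extension to all of \<open>L\<^sup>2\<close> by density is not modelled.\<close>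

definition fourier_multiplier ::
  "('a::euclidean_space \<Rightarrow> complex) \<Rightarrow> ('a \<Rightarrow> complex) \<Rightarrow> 'a \<Rightarrow> complex" where
  "fourier_multiplier m f = inv_fourier (\<lambda>\<xi>. m \<xi> * fourier f \<xi>)"

text \<open>The value at the origin is the continuous extension of the quotient.\<close>

definition wave_symbol :: "real \<Rightarrow> 'a::euclidean_space \<Rightarrow> real" where
  "wave_symbol t \<xi> =
     (if \<xi> = 0 then t else sin (2 * pi * norm \<xi> * t) / (2 * pi * norm \<xi>))"

definition wave_propagator ::
  "real \<Rightarrow> ('a::euclidean_space \<Rightarrow> complex) \<Rightarrow> 'a \<Rightarrow> complex" where
  "wave_propagator t = fourier_multiplier (\<lambda>\<xi>. complex_of_real (wave_symbol t \<xi>))"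

definition tf_shift ::
  "'a \<times> 'a \<Rightarrow> ('a::euclidean_space \<Rightarrow> complex) \<Rightarrow> 'a \<Rightarrow> complex" where
  "tf_shift = (\<lambda>(x, \<xi>) f u. cis (2 * pi * (\<xi> \<bullet> u)) * f (u - x))"

definition L2_inner :: "('a::euclidean_space \<Rightarrow> complex) \<Rightarrow> ('a \<Rightarrow> complex) \<Rightarrow> complex" where
  "L2_inner f g = (LINT u|lborel. f u * cnj (g u))"

definition gaussian :: "'a::euclidean_space \<Rightarrow> complex" where
  "gaussian u = complex_of_real (exp (- pi * (norm u)\<^sup>2))"

end

theory Submission
  imports Defs "HOL-Probability.Characteristic_Functions"
begin

text \<open>In dimension three the wave propagator averages over spheres: up to the total mass \<open>t\<close>, it replaces a
  function by the mean of its translates by vectors \<open>s\<close> of length \<open>t\<close> (Kirchhoff's formula). The inner product of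
  two time-frequency shifted Gaussians has modulus at most
  \<open>exp (- pi / 2 * (norm (x - y))\<^sup>2) * exp (- pi / 2 * (norm (\<xi> - \<eta>))\<^sup>2)\<close>, and translating the first by \<open>s\<close> moves \<open>x\<close> to
  \<open>x + s\<close>, whose distance from \<open>y\<close> is at least \<open>\<bar>norm (x - y) - t\<bar>\<close>. Averaging over \<open>s\<close> gives the bound.

  The proof works on the frequency side, with spheres replaced by thin shells, so that only Lebesgue
  measure is involved. By Parseval's formula (\<open>L2_inner_inv_fourier\<close>) the inner product is the integral of the
  wave symbol against the product of the two transforms (\<open>fourier_tf_shift_gaussian\<close>), that is, up to a phase and the factor
  \<open>exp (- pi / 2 * (norm (\<xi> - \<eta>))\<^sup>2)\<close>, against one modulated Gaussian. The wave symbol is the limit of the normalised Fourier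
  transforms of the shells with radii \<open>t\<close> and \<open>t + h\<close> (\<open>shell_transform_tendsto_wave_symbol\<close>); this comes from
  the explicit transform of a ball (\<open>inv_fourier_indicator_cball\<close>). For a shell, Parseval's formula leads back to
  an average of Gaussians over the points of the shell, which the triangle inequality bounds
  (\<open>shell_gaussian_bound\<close>), and the limit of vanishing thickness is taken in \<open>wave_symbol_gaussian_bound\<close>.\<close>

section \<open>Gaussian integrals\<close>

lemma has_bochner_integral_lborel_translate:
  fixes f :: "'a::euclidean_space \<Rightarrow> 'b::{banach, second_countable_topology}"
  assumes "has_bochner_integral lborel f I"
  shows "has_bochner_integral lborel (\<lambda>x. f (c + x)) I"
proof -
  have f: "f \<in> borel_measurable borel"
    using assms by (auto simp: has_bochner_integral_iff dest: borel_measurable_integrable)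
  have p: "(+) c \<in> measurable lborel borel" by simp
  have "has_bochner_integral (distr lborel borel ((+) c)) f I"
    using assms by (simp add: lborel_distr_plus)
  then show ?thesis
    by (simp only: has_bochner_integral_iff integrable_distr_eq[OF p f] integral_distr[OF p f])
qed

text \<open>Substituting \<open>x = sqrt (2 * pi * a) * u\<close> turns the characteristic function of the standard
  normal distribution into this integral.\<close>

lemma has_bochner_integral_gaussian_cis_real:
  fixes a s :: real
  assumes "a > 0"
  shows "has_bochner_integral lborel (\<lambda>u. cis (2 * pi * (s * u)) * complex_of_real (exp (- pi * a * u\<^sup>2)))
    (complex_of_real (exp (- pi * s\<^sup>2 / a) / sqrt a))"
proof -
  define c where "c = sqrt (2 * pi * a)"
  define \<tau> where "\<tau> = 2 * pi * s / c"
  have c: "c > 0" "c\<^sup>2 = 2 * pi * a" "c / sqrt (2 * pi) = sqrt a"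
    using assms by (auto simp: c_def real_sqrt_mult power_mult_distrib)
  interpret real_distribution std_normal_distribution by (rule real_dist_normal_dist)
  have "integrable std_normal_distribution (\<lambda>x. iexp (\<tau> * x))"
    by (rule integrable_iexp) auto
  then have int: "integrable lborel (\<lambda>x. std_normal_density x *\<^sub>R iexp (\<tau> * x))"
    by (subst (asm) integrable_density) (auto simp: normal_density_nonneg)
  have "char std_normal_distribution \<tau> = (LINT x|lborel. std_normal_density x *\<^sub>R iexp (\<tau> * x))"
    unfolding char_def by (subst integral_density) (auto simp: normal_density_nonneg)
  then have "has_bochner_integral lborel (\<lambda>x. std_normal_density x *\<^sub>R iexp (\<tau> * x))
      (complex_of_real (exp (- \<tau>\<^sup>2 / 2)))"
    using int by (simp add: has_bochner_integral_iff char_std_normal_distribution)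
  from lborel_has_bochner_integral_real_affine_iff[THEN iffD1, OF _ this, of c 0] c
  have "has_bochner_integral lborel (\<lambda>x. std_normal_density (c * x) *\<^sub>R iexp (\<tau> * (c * x)))
      (complex_of_real (exp (- \<tau>\<^sup>2 / 2)) /\<^sub>R c)"
    by simp
  then have "has_bochner_integral lborel
     (\<lambda>x. sqrt (2 * pi) *\<^sub>R (std_normal_density (c * x) *\<^sub>R iexp (\<tau> * (c * x))))
     (sqrt (2 * pi) *\<^sub>R (complex_of_real (exp (- \<tau>\<^sup>2 / 2)) /\<^sub>R c))"
    by (intro has_bochner_integral_scaleR_right)
  also have "(\<lambda>x. sqrt (2 * pi) *\<^sub>R (std_normal_density (c * x) *\<^sub>R iexp (\<tau> * (c * x)))) =
     (\<lambda>u. cis (2 * pi * (s * u)) * complex_of_real (exp (- pi * a * u\<^sup>2)))"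
    using c(1,2) by (auto simp: fun_eq_iff std_normal_density_def power_mult_distrib cis_conv_exp
      \<tau>_def scaleR_conv_of_real mult_ac)
  also have "sqrt (2 * pi) *\<^sub>R (complex_of_real (exp (- \<tau>\<^sup>2 / 2)) /\<^sub>R c) =
      complex_of_real (exp (- \<tau>\<^sup>2 / 2) / (c / sqrt (2 * pi)))"
    by (simp add: scaleR_conv_of_real field_simps)
  also have "\<tau>\<^sup>2 / 2 = pi * s\<^sup>2 / a"
    using assms c(2) by (simp add: \<tau>_def power_mult_distrib power_divide field_simps power2_eq_square)
  then have "- \<tau>\<^sup>2 / 2 = - pi * s\<^sup>2 / a" by simp
  finally show ?thesis by (simp only: c(3))
qed

text \<open>Lebesgue measure on a Euclidean space is the product of its coordinate measures, so the integral
  of a product of functions of one coordinate each factors. This carries the one-dimensional Gaussian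
  integral to every dimension.\<close>

lemma has_bochner_integral_lborel_prod:
  fixes f :: "'a::euclidean_space \<Rightarrow> real \<Rightarrow> 'b::{real_normed_field,banach,second_countable_topology}"
  assumes "\<And>b. b \<in> Basis \<Longrightarrow> has_bochner_integral lborel (f b) (I b)"
  shows "has_bochner_integral lborel (\<lambda>x. \<Prod>b\<in>Basis. f b (x \<bullet> b)) (\<Prod>b\<in>Basis. I b)"
proof -
  interpret product_sigma_finite "\<lambda>_::'a. lborel :: real measure" ..
  have f: "integrable lborel (f b)" "integral\<^sup>L lborel (f b) = I b" if "b \<in> Basis" for b
    using assms[OF that] by (auto simp: has_bochner_integral_iff)
  have [measurable]: "f b \<in> borel_measurable borel" if "b \<in> Basis" for b
    using borel_measurable_integrable[OF f(1)[OF that]] by simp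
  have [measurable]: "(\<lambda>x::'a \<Rightarrow> real. \<Sum>b\<in>Basis. x b *\<^sub>R b) \<in> Pi\<^sub>M Basis (\<lambda>_. lborel) \<rightarrow>\<^sub>M borel"
    by measurable
  have eq: "(\<Prod>b\<in>Basis. f b ((\<Sum>b\<in>Basis. x b *\<^sub>R b) \<bullet> b)) = (\<Prod>b\<in>Basis. f b (x b))" for x
    by (intro prod.cong) auto
  have m: "(\<lambda>x. \<Prod>b\<in>Basis. f b (x \<bullet> b)) \<in> borel_measurable borel"
    by measurable
  have "integrable (Pi\<^sub>M Basis (\<lambda>_. lborel)) (\<lambda>x. \<Prod>b\<in>Basis. f b (x b))"
    by (rule product_integrable_prod) (auto intro: f)
  moreover have "(LINT x|Pi\<^sub>M Basis (\<lambda>_. lborel). (\<Prod>b\<in>Basis. f b (x b))) = (\<Prod>b\<in>Basis. I b)"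
    by (subst product_integral_prod) (auto simp: f intro!: prod.cong)
  ultimately show ?thesis
    unfolding has_bochner_integral_iff
    by (subst (1 2) lborel_eq) (simp add: integrable_distr_eq integral_distr m eq)
qed

lemma has_bochner_integral_gaussian_cis:
  fixes v :: "'a::euclidean_space"
  assumes "a > 0"
  shows "has_bochner_integral lborel
    (\<lambda>u. cis (2 * pi * (v \<bullet> u)) * complex_of_real (exp (- pi * a * (norm u)\<^sup>2)))
    (complex_of_real (exp (- pi * (norm v)\<^sup>2 / a) / sqrt a ^ DIM('a)))"
proof -
  have "has_bochner_integral lborel
    (\<lambda>u. \<Prod>b\<in>Basis. cis (2 * pi * ((v \<bullet> b) * (u \<bullet> b))) * complex_of_real (exp (- pi * a * (u \<bullet> b)\<^sup>2)))
    (\<Prod>b\<in>Basis. complex_of_real (exp (- pi * (v \<bullet> b)\<^sup>2 / a) / sqrt a))"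
    by (rule has_bochner_integral_lborel_prod) (rule has_bochner_integral_gaussian_cis_real[OF assms])
  moreover have "(\<Prod>b\<in>Basis. cis (2 * pi * ((v \<bullet> b) * (u \<bullet> b))) * complex_of_real (exp (- pi * a * (u \<bullet> b)\<^sup>2)))
     = cis (2 * pi * (v \<bullet> u)) * complex_of_real (exp (- pi * a * (norm u)\<^sup>2))" for u
    by (simp add: prod.distrib cis_conv_exp power2_norm_eq_inner euclidean_inner[of u u]
      euclidean_inner[of v u] sum_distrib_left exp_sum power2_eq_square[of "_ \<bullet> _"] flip: of_real_prod sum_negf)
  moreover have "(\<Prod>b\<in>Basis. complex_of_real (exp (- pi * (v \<bullet> b)\<^sup>2 / a) / sqrt a)) =
     (complex_of_real (exp (- pi * (norm v)\<^sup>2 / a) / sqrt a ^ DIM('a)))"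
    by (simp add: prod_dividef power2_norm_eq_inner euclidean_inner[of v v]
      sum_distrib_left sum_divide_distrib exp_sum power2_eq_square[of "_ \<bullet> _"] flip: of_real_prod sum_negf)
  ultimately show ?thesis by simp
qed

lemma has_bochner_integral_shifted_gaussian_cis:
  fixes v c :: "'a::euclidean_space"
  assumes "a > 0"
  shows "has_bochner_integral lborel
    (\<lambda>u. cis (2 * pi * (v \<bullet> u)) * complex_of_real (exp (- pi * a * (norm (u - c))\<^sup>2)))
    (cis (2 * pi * (v \<bullet> c)) * complex_of_real (exp (- pi * (norm v)\<^sup>2 / a) / sqrt a ^ DIM('a)))"
proof -
  have "has_bochner_integral lborel
    (\<lambda>u. cis (2 * pi * (v \<bullet> c)) *
      (cis (2 * pi * (v \<bullet> (- c + u))) * complex_of_real (exp (- pi * a * (norm (- c + u))\<^sup>2))))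
    (cis (2 * pi * (v \<bullet> c)) * complex_of_real (exp (- pi * (norm v)\<^sup>2 / a) / sqrt a ^ DIM('a)))"
    by (intro has_bochner_integral_mult_right
      has_bochner_integral_lborel_translate[OF has_bochner_integral_gaussian_cis[OF assms]])
  moreover have "cis (2 * pi * (v \<bullet> c)) * (cis (2 * pi * (v \<bullet> (- c + u))) * z) = cis (2 * pi * (v \<bullet> u)) * z"
    for u z
    by (simp add: cis_mult inner_add_right algebra_simps flip: mult.assoc[of "cis _" "cis _"])
  ultimately show ?thesis by (simp only: add.commute[of "- c"] add_uminus_conv_diff)
qed

section \<open>Fourier transforms and Parseval's formula\<close>

lemma borel_measurable_inv_fourier [measurable]:
  assumes [measurable]: "f \<in> borel_measurable borel"
  shows "inv_fourier f \<in> borel_measurable borel"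
  unfolding inv_fourier_def[abs_def] cis_conv_exp
  by (rule sigma_finite_measure.borel_measurable_lebesgue_integral[OF sigma_finite_lborel]) measurable

lemma borel_measurable_wave_symbol [measurable]: "wave_symbol t \<in> borel_measurable borel"
  unfolding wave_symbol_def[abs_def] by measurable

text \<open>Parseval's formula in the form that Fubini gives: for two integrable functions the double integral
  converges absolutely and may be read in either order. It lets the inner product with a
  wave be computed without ever evaluating the wave in space.\<close>

lemma L2_inner_inv_fourier:
  fixes h f :: "'a::euclidean_space \<Rightarrow> complex"
  assumes h: "integrable lborel h" and f: "integrable lborel f"
  shows "L2_inner (inv_fourier h) f = (LINT \<omega>|lborel. h \<omega> * cnj (fourier f \<omega>))"
proof -
  have [measurable]: "h \<in> borel_measurable borel" "f \<in> borel_measurable borel"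
    using h f by (auto dest: borel_measurable_integrable)
  have [measurable]: "cnj \<in> borel_measurable borel"
    by (intro borel_measurable_continuous_onI continuous_intros)
  have int: "integrable (lborel \<Otimes>\<^sub>M lborel) (\<lambda>(u, \<omega>). h \<omega> * cis (2 * pi * (u \<bullet> \<omega>)) * cnj (f u))"
  proof (rule lborel_pair.Fubini_integrable)
    have *: "integrable lborel (\<lambda>\<omega>. h \<omega> * cis (2 * pi * (u \<bullet> \<omega>)))" for u
      by (rule Bochner_Integration.integrable_bound[OF h]) (auto simp: norm_mult cis_conv_exp)
    then show "AE u in lborel. integrable lborel (\<lambda>\<omega>. case (u, \<omega>) of (u, \<omega>) \<Rightarrow> h \<omega> * cis (2 * pi * (u \<bullet> \<omega>)) * cnj (f u))"
      by simp
    show "integrable lborel (\<lambda>u. LINT \<omega>|lborel. norm (case (u, \<omega>) of (u, \<omega>) \<Rightarrow> h \<omega> * cis (2 * pi * (u \<bullet> \<omega>)) * cnj (f u)))"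
      using f by (simp add: norm_mult)
    show "(\<lambda>(u, \<omega>). h \<omega> * cis (2 * pi * (u \<bullet> \<omega>)) * cnj (f u)) \<in> borel_measurable (lborel \<Otimes>\<^sub>M lborel)"
      unfolding cis_conv_exp by measurable
  qed
  have "L2_inner (inv_fourier h) f =
      (LINT u|lborel. LINT \<omega>|lborel. h \<omega> * cis (2 * pi * (u \<bullet> \<omega>)) * cnj (f u))"
    by (simp add: L2_inner_def inv_fourier_def)
  also have "\<dots> = (LINT \<omega>|lborel. LINT u|lborel. h \<omega> * cis (2 * pi * (u \<bullet> \<omega>)) * cnj (f u))"
    using lborel_pair.Fubini_integral[OF int] by simp
  also have "\<dots> = (LINT \<omega>|lborel. h \<omega> * cnj (fourier f \<omega>))"
    by (simp add: fourier_def cis_cnj mult_ac flip: Bochner_Integration.integral_cnj integral_mult_right_zero)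
  finally show ?thesis .
qed

text \<open>The Gaussian is its own Fourier transform, and the transform swaps translation and modulation.\<close>

lemma fourier_tf_shift_gaussian:
  fixes x \<xi> \<omega> :: "'a::euclidean_space"
  shows "fourier (tf_shift (x, \<xi>) gaussian) \<omega> = cis (2 * pi * (x \<bullet> (\<xi> - \<omega>))) * gaussian (\<omega> - \<xi>)"
proof -
  have "cis (2 * pi * (\<xi> \<bullet> u)) * gaussian (u - x) * cis (- 2 * pi * (u \<bullet> \<omega>)) =
      cis (2 * pi * ((\<xi> - \<omega>) \<bullet> u)) * complex_of_real (exp (- pi * 1 * (norm (u - x))\<^sup>2))" for u
  proof -
    have "cis (2 * pi * (\<xi> \<bullet> u)) * cis (- 2 * pi * (u \<bullet> \<omega>)) = cis (2 * pi * ((\<xi> - \<omega>) \<bullet> u))"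
      unfolding cis_mult by (rule arg_cong[of _ _ cis]) (simp add: algebra_simps inner_commute)
    then show ?thesis by (simp add: gaussian_def mult_ac)
  qed
  then have "fourier (tf_shift (x, \<xi>) gaussian) \<omega> =
    (LINT u|lborel. cis (2 * pi * ((\<xi> - \<omega>) \<bullet> u)) * complex_of_real (exp (- pi * 1 * (norm (u - x))\<^sup>2)))"
    by (simp add: fourier_def tf_shift_def)
  also have "\<dots> = cis (2 * pi * (x \<bullet> (\<xi> - \<omega>))) * gaussian (\<omega> - \<xi>)"
    using has_bochner_integral_shifted_gaussian_cis[of 1 "\<xi> - \<omega>" x]
    by (simp add: has_bochner_integral_iff gaussian_def norm_minus_commute inner_commute[of x])
  finally show ?thesis .
qed

section \<open>Integrals over balls\<close>

text \<open>Lebesgue measure is determined by the volumes of boxes, and orthogonal maps preserve volume.\<close>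

lemma lborel_distr_orthogonal:
  fixes f :: "real^'n::{finite,wellorder} \<Rightarrow> real^'n::_"
  assumes "orthogonal_transformation f"
  shows "distr lborel borel f = lborel"
proof (rule lborel_eqI[symmetric])
  fix l u :: "real^'n::_"
  assume le: "\<And>b. b \<in> Basis \<Longrightarrow> l \<bullet> b \<le> u \<bullet> b"
  obtain g where g: "orthogonal_transformation g" "\<And>x. g (f x) = x" "\<And>x. f (g x) = x"
    using assms orthogonal_transformation_inv[OF assms] orthogonal_transformation_bij[OF assms]
    by (metis bij_inv_eq_iff)
  have [measurable]: "f \<in> borel_measurable borel"
    using assms by (intro borel_measurable_continuous_onI linear_continuous_on
      orthogonal_transformation_linear linear_conv_bounded_linear[THEN iffD1])
  have eq: "f -` box l u = g ` box l u"
    using g(2,3) by (auto simp: image_iff) (metis g(2))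
  have b: "f -` box l u \<in> sets borel"
    using measurable_sets[of f borel borel "box l u"] by auto
  have "emeasure (distr lborel borel f) (box l u) = emeasure lborel (g ` box l u)"
    by (simp add: emeasure_distr eq)
  also have "\<dots> = emeasure lebesgue (g ` box l u)"
    using b by (simp add: eq)
  also have "\<dots> = measure lebesgue (g ` box l u)"
    using measurable_orthogonal_image[OF g(1), of "box l u"]
    by (intro emeasure_eq_measure2) auto
  also have "\<dots> = measure lebesgue (box l u)"
    using measure_orthogonal_image[OF g(1), of "box l u"] by simp
  also have "\<dots> = (\<Prod>b\<in>Basis. (u - l) \<bullet> b)"
    using le by (simp add: measure_lborel_box_eq)
  finally show "emeasure (distr lborel borel f) (box l u) = (\<Prod>b\<in>Basis. (u - l) \<bullet> b)" .
qed simp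

text \<open>The unnormalised law of one coordinate of a point in a ball: at height \<open>z\<close> the ball is cut in a ball of one
  dimension less with radius \<open>sqrt (R\<^sup>2 - z\<^sup>2)\<close>, whose volume is the density.\<close>

lemma distr_cball_inner_Basis:
  fixes e :: "'a::euclidean_space"
  assumes e: "e \<in> Basis" and "R > 0"
  shows "distr (density lborel (indicator (cball (0::'a) R))) borel (\<lambda>x. x \<bullet> e) =
    density lborel (\<lambda>z. indicator {-R..R} z *
      ennreal (unit_ball_vol (real (DIM('a) - 1)) * sqrt (R\<^sup>2 - z\<^sup>2) ^ (DIM('a) - 1)))"
    (is "?L = ?D")
proof (rule measure_eqI)
  show "sets ?L = sets ?D" by simp
  interpret product_sigma_finite "\<lambda>_::'a. lborel :: real measure" ..
  define A where "A = (Basis :: 'a set) - {e}"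
  have A: "finite A" "e \<notin> A" "insert e A = Basis" "card A = DIM('a) - 1"
    using e by (auto simp: A_def)
  let ?P = "\<lambda>A. Pi\<^sub>M A (\<lambda>_::'a. lborel :: real measure)"
  have [measurable]: "(\<lambda>x::'a \<Rightarrow> real. \<Sum>b\<in>Basis. x b *\<^sub>R b) \<in> ?P Basis \<rightarrow>\<^sub>M borel"
    by measurable
  fix X assume "X \<in> sets ?L"
  then have [measurable]: "X \<in> sets borel" by simp
  define F where "F = (\<lambda>f::'a \<Rightarrow> real. indicator X (f e) *
     indicator {f. sqrt (\<Sum>b\<in>Basis. (f b)\<^sup>2) \<le> R} f :: ennreal)"
  have [measurable]: "F \<in> borel_measurable (?P (insert e A))"
    unfolding F_def A(3) using e by measurable
  have "emeasure ?L X = (\<integral>\<^sup>+x. indicator X (x \<bullet> e) * indicator (cball 0 R) x \<partial>lborel)"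
  proof -
    have [measurable]: "(\<lambda>x::'a. x \<bullet> e) -` X \<in> sets borel"
      using measurable_sets[of "\<lambda>x::'a. x \<bullet> e" borel borel X] by simp
    have "emeasure ?L X = emeasure (density lborel (indicator (cball (0::'a) R))) ((\<lambda>x. x \<bullet> e) -` X)"
      by (subst emeasure_distr) auto
    also have "\<dots> = (\<integral>\<^sup>+x. indicator (cball 0 R) x * indicator ((\<lambda>x. x \<bullet> e) -` X) x \<partial>lborel)"
      by (rule emeasure_density) (auto intro: borel_measurable_indicator)
    also have "\<dots> = (\<integral>\<^sup>+x. indicator X (x \<bullet> e) * indicator (cball 0 R) x \<partial>lborel)"
      by (intro nn_integral_cong) (auto simp: indicator_def)
    finally show ?thesis .
  qed
  also have "\<dots> = (\<integral>\<^sup>+f. F f \<partial>?P Basis)"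
  proof -
    have nrm: "norm x = sqrt (\<Sum>b\<in>Basis. (x \<bullet> b)\<^sup>2)" for x :: 'a
      unfolding norm_eq_sqrt_inner by (subst euclidean_inner) (simp add: power2_eq_square)
    have [measurable]: "cball (0::'a) R \<in> sets borel" by simp
    have [measurable]: "(\<lambda>x::'a. indicator (cball 0 R) x :: ennreal) \<in> borel_measurable borel"
      by (rule borel_measurable_indicator) simp
    have "(\<integral>\<^sup>+x. indicator X (x \<bullet> e) * indicator (cball 0 R) x \<partial>lborel) =
      (\<integral>\<^sup>+f. indicator X ((\<Sum>b\<in>Basis. f b *\<^sub>R b) \<bullet> e) * indicator (cball 0 R) (\<Sum>b\<in>Basis. f b *\<^sub>R b) \<partial>?P Basis)"
      by (subst lborel_eq, subst nn_integral_distr) simp_all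
    also have "\<dots> = (\<integral>\<^sup>+f. F f \<partial>?P Basis)"
    proof (rule arg_cong[where f = "nn_integral (?P Basis)"], rule ext)
      fix f :: "'a \<Rightarrow> real"
      have "(\<Sum>b\<in>Basis. f b *\<^sub>R b) \<bullet> b = f b" if "b \<in> Basis" for b
        using that by simp
      then show "indicator X ((\<Sum>b\<in>Basis. f b *\<^sub>R b) \<bullet> e) * indicator (cball 0 R) (\<Sum>b\<in>Basis. f b *\<^sub>R b) = F f"
        using e by (simp add: F_def indicator_def nrm)
    qed
    finally show ?thesis .
  qed
  also have "\<dots> = (\<integral>\<^sup>+z. (\<integral>\<^sup>+f. F (f(e := z)) \<partial>?P A) \<partial>lborel)"
    unfolding A(3)[symmetric] by (rule product_nn_integral_insert_rev) (use A(1,2) in measurable)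
  also have "\<dots> = (\<integral>\<^sup>+z. (\<integral>\<^sup>+f. indicator X z * indicator {-R..R} z *
      indicator ({f. sqrt (\<Sum>b\<in>A. (f b)\<^sup>2) \<le> sqrt (R\<^sup>2 - z\<^sup>2)} \<inter> space (?P A)) f \<partial>?P A) \<partial>lborel)"
  proof (intro nn_integral_cong)
    fix z f assume f: "f \<in> space (?P A)"
    have s: "(\<Sum>b\<in>Basis. ((f(e := z)) b)\<^sup>2) = z\<^sup>2 + (\<Sum>b\<in>A. (f b)\<^sup>2)"
      unfolding A(3)[symmetric] using A(1,2) by (auto intro!: sum.cong)
    have nn: "0 \<le> (\<Sum>b\<in>A. (f b)\<^sup>2)" by (simp add: sum_nonneg)
    have "sqrt (z\<^sup>2 + (\<Sum>b\<in>A. (f b)\<^sup>2)) \<le> R \<longleftrightarrow> z\<^sup>2 + (\<Sum>b\<in>A. (f b)\<^sup>2) \<le> R\<^sup>2"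
      using \<open>R > 0\<close> nn by (intro real_sqrt_le_iff') auto
    also have "\<dots> \<longleftrightarrow> z \<in> {-R..R} \<and> sqrt (\<Sum>b\<in>A. (f b)\<^sup>2) \<le> sqrt (R\<^sup>2 - z\<^sup>2)"
    proof -
      have "\<bar>z\<bar> \<le> R" if "z\<^sup>2 + (\<Sum>b\<in>A. (f b)\<^sup>2) \<le> R\<^sup>2"
        using that nn \<open>R > 0\<close> by (intro power2_le_imp_le[of "\<bar>z\<bar>"]) auto
      then show ?thesis
        unfolding real_sqrt_le_iff le_diff_eq by (auto simp: add.commute abs_le_iff)
    qed
    finally show "F (f(e := z)) = indicator X z * indicator {-R..R} z *
      indicator ({f. sqrt (\<Sum>b\<in>A. (f b)\<^sup>2) \<le> sqrt (R\<^sup>2 - z\<^sup>2)} \<inter> space (?P A)) f"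
      using f unfolding F_def indicator_def s[symmetric] by auto
  qed
  also have "\<dots> = (\<integral>\<^sup>+z. indicator X z * indicator {-R..R} z *
      emeasure (?P A) ({f. sqrt (\<Sum>b\<in>A. (f b)\<^sup>2) \<le> sqrt (R\<^sup>2 - z\<^sup>2)} \<inter> space (?P A)) \<partial>lborel)"
    using A(1) by (intro nn_integral_cong, subst nn_integral_cmult_indicator) auto
  also have "\<dots> = (\<integral>\<^sup>+z. (indicator {-R..R} z *
      ennreal (unit_ball_vol (real (DIM('a) - 1)) * sqrt (R\<^sup>2 - z\<^sup>2) ^ (DIM('a) - 1))) * indicator X z \<partial>lborel)"
  proof (intro nn_integral_cong_AE)
    \<comment> \<open>The volume formula for the slices needs a positive radius, which fails at the two poles.\<close>
    have "AE z in lborel. z \<notin> {-R, R}"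
      by (intro AE_not_in countable_imp_null_set_lborel) auto
    then show "AE z in lborel. indicator X z * indicator {-R..R} z *
      emeasure (?P A) ({f. sqrt (\<Sum>b\<in>A. (f b)\<^sup>2) \<le> sqrt (R\<^sup>2 - z\<^sup>2)} \<inter> space (?P A)) =
      (indicator {-R..R} z *
      ennreal (unit_ball_vol (real (DIM('a) - 1)) * sqrt (R\<^sup>2 - z\<^sup>2) ^ (DIM('a) - 1))) * indicator X z"
    proof eventually_elim
      case (elim z)
      show ?case
      proof (cases "z \<in> {-R<..<R}")
        case True
        then have "z\<^sup>2 < R\<^sup>2" by (subst real_sqrt_less_iff [symmetric]) auto
        then show ?thesis
          using emeasure_cball_aux[OF A(1), of "sqrt (R\<^sup>2 - z\<^sup>2)"] by (simp add: A(4) mult_ac)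
      qed (use elim in auto)
    qed
  qed
  also have "\<dots> = emeasure ?D X"
    by (subst emeasure_density) auto
  finally show "emeasure ?L X = emeasure ?D X" .
qed

text \<open>A function of \<open>x \<bullet> \<omega>\<close> is integrated over a ball by rotating \<open>\<omega>\<close> to a coordinate axis and slicing
  orthogonally to it; in dimension three the slices are discs of area \<open>pi * (R\<^sup>2 - z\<^sup>2)\<close>.\<close>

lemma integral_cball_inner:
  fixes \<omega> :: "real^3" and f :: "real \<Rightarrow> complex"
  assumes [measurable]: "f \<in> borel_measurable borel" and "R > 0"
  shows "(LINT x|lborel. indicator (cball (0::real^3) R) x *\<^sub>R f (x \<bullet> \<omega>)) =
    (LINT z|lborel. indicator {-R..R} z *\<^sub>R (complex_of_real (pi * (R\<^sup>2 - z\<^sup>2)) * f (norm \<omega> * z)))"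
proof -
  define e :: "real^3" where "e = axis 1 1"
  have e: "e \<in> Basis" "norm e = 1" by (auto simp: e_def)
  have "norm \<omega> = norm (norm \<omega> *\<^sub>R e)" using e by simp
  from orthogonal_transformation_exists[OF this]
  obtain T where T: "orthogonal_transformation T" "T \<omega> = norm \<omega> *\<^sub>R e" by blast
  have [measurable]: "T \<in> borel_measurable borel"
    using T(1) by (intro borel_measurable_continuous_onI linear_continuous_on
      orthogonal_transformation_linear linear_conv_bounded_linear[THEN iffD1])
  have T_simps: "norm (T x) = norm x" "T x \<bullet> (norm \<omega> *\<^sub>R e) = x \<bullet> \<omega>" for x
    using T(1) unfolding T(2)[symmetric]
    by (auto simp: orthogonal_transformation_norm orthogonal_transformation_def)
  have [measurable]: "(\<lambda>x. indicator (cball (0::real^3) R) x :: real) \<in> borel_measurable borel"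
    by (rule borel_measurable_indicator) simp
  let ?g = "\<lambda>z. f (norm \<omega> * z)"
  have "(LINT x|lborel. indicator (cball (0::real^3) R) x *\<^sub>R ?g (x \<bullet> e)) =
      (LINT x|distr lborel borel T. indicator (cball (0::real^3) R) x *\<^sub>R ?g (x \<bullet> e))"
    by (simp add: lborel_distr_orthogonal[OF T(1)])
  also have "\<dots> = (LINT x|lborel. indicator (cball 0 R) (T x) *\<^sub>R ?g (T x \<bullet> e))"
    by (rule integral_distr) measurable
  also have "\<dots> = (LINT x|lborel. indicator (cball (0::real^3) R) x *\<^sub>R f (x \<bullet> \<omega>))"
    using T_simps by (intro Bochner_Integration.integral_cong) (auto simp: indicator_def)
  finally have "(LINT x|lborel. indicator (cball (0::real^3) R) x *\<^sub>R f (x \<bullet> \<omega>)) =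
      (LINT x|lborel. indicator (cball (0::real^3) R) x *\<^sub>R ?g (x \<bullet> e))" by simp
  also have "\<dots> = (LINT x|density lborel (\<lambda>x. ennreal (indicator (cball (0::real^3) R) x)). ?g (x \<bullet> e))"
    by (subst integral_density) auto
  also have "\<dots> = (LINT z|distr (density lborel (indicator (cball (0::real^3) R))) borel (\<lambda>x. x \<bullet> e). ?g z)"
    by (subst integral_distr) (auto simp: ennreal_indicator)
  also have "\<dots> = (LINT z|density lborel (\<lambda>z. ennreal (indicator {-R..R} z * (pi * (R\<^sup>2 - z\<^sup>2)))). ?g z)"
  proof -
    have "indicator {-R..R} z * ennreal (unit_ball_vol (real (DIM(real^3) - 1)) * sqrt (R\<^sup>2 - z\<^sup>2) ^ (DIM(real^3) - 1))
      = ennreal (indicator {-R..R} z * (pi * (R\<^sup>2 - z\<^sup>2)))" for z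
    proof (cases "z \<in> {-R..R}")
      case True
      then have "z\<^sup>2 \<le> R\<^sup>2" by (intro power2_le_iff_abs_le[THEN iffD2]) auto
      then show ?thesis using True by (simp add: unit_ball_vol_2)
    qed simp
    then show ?thesis
      by (simp only: distr_cball_inner_Basis[OF e(1) \<open>R > 0\<close>])
  qed
  also have "\<dots> = (LINT z|lborel. (indicator {-R..R} z * (pi * (R\<^sup>2 - z\<^sup>2))) *\<^sub>R ?g z)"
  proof (rule integral_density)
    have "z\<^sup>2 \<le> R\<^sup>2" if "z \<in> {-R..R}" for z
      using that by (intro power2_le_iff_abs_le[THEN iffD2]) auto
    then show "AE z in lborel. 0 \<le> indicator {-R..R} z * (pi * (R\<^sup>2 - z\<^sup>2))"
      by (auto simp: indicator_def)
  qed auto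
  also have "\<dots> = (LINT z|lborel. indicator {-R..R} z *\<^sub>R (complex_of_real (pi * (R\<^sup>2 - z\<^sup>2)) * ?g z))"
    by (simp add: scaleR_conv_of_real mult_ac)
  finally show ?thesis .
qed

text \<open>After slicing, the exponential is integrated against a quadratic polynomial, and repeated
  integration by parts gives an antiderivative. Its imaginary part is even and cancels between the two
  poles.\<close>

lemma inv_fourier_indicator_cball:
  fixes \<omega> :: "real^3"
  assumes "R > 0" "\<omega> \<noteq> 0"
  defines "\<kappa> \<equiv> 2 * pi * norm \<omega>"
  shows "inv_fourier (indicator (cball 0 R)) \<omega> =
    complex_of_real (4 * pi * (sin (\<kappa> * R) / \<kappa>^3 - R * cos (\<kappa> * R) / \<kappa>^2))"
proof -
  have \<kappa>: "\<kappa> > 0" using assms by simp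
  have "inv_fourier (indicator (cball 0 R)) \<omega> =
    (LINT x|lborel. indicator (cball (0::real^3) R) x *\<^sub>R cis (2 * pi * (x \<bullet> \<omega>)))"
    unfolding inv_fourier_def
    by (intro Bochner_Integration.integral_cong) (auto simp: indicator_def inner_commute[of \<omega>])
  also have "\<dots> = (LINT z|lborel. indicator {-R..R} z *\<^sub>R
      (complex_of_real (pi * (R\<^sup>2 - z\<^sup>2)) * cis (2 * pi * (norm \<omega> * z))))"
    by (rule integral_cball_inner[where f = "\<lambda>s. cis (2 * pi * s)"])
      (auto simp: cis_conv_exp \<open>R > 0\<close>)
  also have "\<dots> = (LINT z|lborel. indicator {-R..R} z *\<^sub>R
      Complex (pi * (R\<^sup>2 - z\<^sup>2) * cos (\<kappa> * z)) (pi * (R\<^sup>2 - z\<^sup>2) * sin (\<kappa> * z)))"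
    by (intro Bochner_Integration.integral_cong refl arg_cong[of _ _ "\<lambda>z. _ *\<^sub>R z"])
      (simp add: \<kappa>_def complex_eq_iff mult_ac)
  also have "\<dots> =
      (let F = (\<lambda>z. Complex
        (pi * ((R\<^sup>2 - z\<^sup>2) * sin (\<kappa> * z) / \<kappa> - 2 * z * cos (\<kappa> * z) / \<kappa>^2 + 2 * sin (\<kappa> * z) / \<kappa>^3))
        (pi * (- (R\<^sup>2 - z\<^sup>2) * cos (\<kappa> * z) / \<kappa> - 2 * z * sin (\<kappa> * z) / \<kappa>^2 - 2 * cos (\<kappa> * z) / \<kappa>^3)))
      in F R - F (- R))"
    unfolding Let_def
  proof (rule integral_FTC_Icc)
    show "continuous_on {- R..R} (\<lambda>x. Complex (pi * (R\<^sup>2 - x\<^sup>2) * cos (\<kappa> * x)) (pi * (R\<^sup>2 - x\<^sup>2) * sin (\<kappa> * x)))"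
      unfolding Complex_eq by (intro continuous_intros)
  next
    fix z
    show "((\<lambda>z. Complex
        (pi * ((R\<^sup>2 - z\<^sup>2) * sin (\<kappa> * z) / \<kappa> - 2 * z * cos (\<kappa> * z) / \<kappa>^2 + 2 * sin (\<kappa> * z) / \<kappa>^3))
        (pi * (- (R\<^sup>2 - z\<^sup>2) * cos (\<kappa> * z) / \<kappa> - 2 * z * sin (\<kappa> * z) / \<kappa>^2 - 2 * cos (\<kappa> * z) / \<kappa>^3)))
      has_vector_derivative Complex (pi * (R\<^sup>2 - z\<^sup>2) * cos (\<kappa> * z)) (pi * (R\<^sup>2 - z\<^sup>2) * sin (\<kappa> * z)))
      (at z within {-R..R})"
      unfolding has_vector_derivative_complex_iff complex.sel
      using \<kappa> by (auto intro!: derivative_eq_intros simp: field_simps power2_eq_square power3_eq_cube)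
  qed (use \<open>R > 0\<close> in auto)
  also have "\<dots> = complex_of_real (4 * pi * (sin (\<kappa> * R) / \<kappa>^3 - R * cos (\<kappa> * R) / \<kappa>^2))"
    using \<kappa> by (auto simp: Let_def complex_eq_iff field_simps power2_eq_square power3_eq_cube)
  finally show ?thesis .
qed

section \<open>The wave symbol as a limit of shell transforms\<close>

lemma abs_wave_symbol_le:
  assumes "t > 0"
  shows "\<bar>wave_symbol t \<omega>\<bar> \<le> t"
proof (cases "\<omega> = 0")
  case False
  have "\<bar>sin (2 * pi * norm \<omega> * t)\<bar> \<le> \<bar>2 * pi * norm \<omega> * t\<bar>"
    by (rule abs_sin_x_le_abs_x)
  then show ?thesis
    using False assms by (simp add: wave_symbol_def abs_mult divide_simps mult_ac)
qed (use assms in \<open>simp add: wave_symbol_def\<close>)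

text \<open>The key identity behind Kirchhoff's formula: differentiating the transform of the ball of radius \<open>t\<close>
  in \<open>t\<close> gives the transform of the surface measure of its boundary, and this is \<open>4 * pi * t\<close> times the wave symbol.
  The terms with \<open>cos\<close> cancel in the derivative, so only the sine quotient is left.\<close>

lemma shell_transform_tendsto_wave_symbol:
  fixes \<omega> :: "real^3"
  assumes "t > 0" "\<omega> \<noteq> 0" and h: "h \<longlonglongrightarrow> 0" "\<And>n. h n > 0"
  shows "(\<lambda>n. (inv_fourier (indicator (cball 0 (t + h n))) \<omega> - inv_fourier (indicator (cball 0 t)) \<omega>) / complex_of_real (h n))
    \<longlonglongrightarrow> complex_of_real (4 * pi * t * wave_symbol t \<omega>)"
proof -
  define \<kappa> where "\<kappa> = 2 * pi * norm \<omega>"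
  define G where "G = (\<lambda>R. 4 * pi * (sin (\<kappa> * R) / \<kappa>^3 - R * cos (\<kappa> * R) / \<kappa>^2))"
  have \<kappa>: "\<kappa> > 0" using assms by (simp add: \<kappa>_def)
  have "(G has_real_derivative (4 * pi * t * (sin (\<kappa> * t) / \<kappa>))) (at t)"
    unfolding G_def using \<kappa>
    by (auto intro!: derivative_eq_intros simp: field_simps power2_eq_square power3_eq_cube)
  then have "(\<lambda>d. (G (t + d) - G t) / d) \<midarrow>0\<rightarrow> 4 * pi * t * (sin (\<kappa> * t) / \<kappa>)"
    by (rule DERIV_D)
  moreover have "filterlim h (at 0) sequentially"
    using h by (auto simp: filterlim_at less_imp_neq[THEN not_sym])
  ultimately have "(\<lambda>n. (G (t + h n) - G t) / h n) \<longlonglongrightarrow> 4 * pi * t * (sin (\<kappa> * t) / \<kappa>)"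
    by (rule filterlim_compose)
  then have "(\<lambda>n. complex_of_real ((G (t + h n) - G t) / h n)) \<longlonglongrightarrow> complex_of_real (4 * pi * t * (sin (\<kappa> * t) / \<kappa>))"
    by (rule tendsto_of_real)
  moreover have "sin (\<kappa> * t) / \<kappa> = wave_symbol t \<omega>"
    using \<open>\<omega> \<noteq> 0\<close> by (simp add: wave_symbol_def \<kappa>_def)
  moreover have "inv_fourier (indicator (cball 0 R)) \<omega> = complex_of_real (G R)" if "R > 0" for R
    unfolding G_def \<kappa>_def using inv_fourier_indicator_cball[OF that \<open>\<omega> \<noteq> 0\<close>] .
  moreover have "t + h n > 0" for n using \<open>t > 0\<close> h(2)[of n] by simp
  ultimately show ?thesis using \<open>t > 0\<close> by simp
qed

section \<open>Shells and Gaussians\<close>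

definition shell :: "real \<Rightarrow> real \<Rightarrow> 'a::real_normed_vector set" where
  "shell r R = cball 0 R - cball 0 r"

lemma integrable_indicator_bounded:
  fixes S :: "'a::euclidean_space set"
  assumes "S \<in> sets borel" "bounded S"
  shows "integrable lborel (indicator S :: _ \<Rightarrow> complex)" "emeasure lborel S < \<infinity>"
proof -
  show *: "emeasure lborel S < \<infinity>" by (rule emeasure_bounded_finite) fact
  have "integrable lborel (\<lambda>x. complex_of_real (indicator S x))"
    using * assms by (intro integrable_of_real integrable_real_indicator) auto
  then show "integrable lborel (indicator S :: _ \<Rightarrow> complex)"
    by (rule Bochner_Integration.integrable_cong[THEN iffD1, rotated -1]) (auto simp: indicator_def)
qed

lemma norm_integral_indicator_mult_le:
  fixes H :: "'a::euclidean_space \<Rightarrow> complex"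
  assumes S: "S \<in> sets borel" "bounded S" and H: "H \<in> borel_measurable borel"
    and le: "\<And>x. x \<in> S \<Longrightarrow> norm (H x) \<le> M"
  shows "norm (LINT x|lborel. indicator S x * H x) \<le> measure lborel S * M"
proof -
  have ind: "integrable lborel (indicator S :: _ \<Rightarrow> real)"
    using integrable_indicator_bounded(2)[OF S] S by (intro integrable_real_indicator) auto
  have *: "norm (indicator S x * H x) \<le> indicator S x * M" for x
    using le[of x] by (cases "x \<in> S") auto
  have "norm (LINT x|lborel. indicator S x * H x) \<le> (LINT x|lborel. indicator S x * M)"
  proof (rule Bochner_Integration.integral_norm_bound_integral)
    show r: "integrable lborel (\<lambda>x. indicator S x * M)" using ind by simp
    show "integrable lborel (\<lambda>x. indicator S x * H x)"
    proof (rule Bochner_Integration.integrable_bound[OF r])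
      show "(\<lambda>x. indicator S x * H x) \<in> borel_measurable lborel"
        using S H by (auto intro!: borel_measurable_times borel_measurable_indicator)
      show "AE x in lborel. norm (indicator S x * H x) \<le> norm (indicator S x * M)"
        using * by (intro AE_I2) (metis abs_ge_self order_trans real_norm_def)
    qed
  qed (rule *)
  then show ?thesis by simp
qed

lemma measure_shell:
  assumes "0 < r" "r \<le> R"
  shows "measure lborel (shell r R :: (real^3) set) = 4 / 3 * pi * (R ^ 3 - r ^ 3)"
proof -
  have "measure lborel (shell r R :: (real^3) set) = measure lborel (cball (0::real^3) R) - measure lborel (cball (0::real^3) r)"
    unfolding shell_def
    using assms emeasure_bounded_finite[OF bounded_cball, of "0::real^3" R]
    by (intro measure_Diff) auto
  then show ?thesis
    using assms by (simp add: content_cball unit_ball_vol_3 algebra_simps power3_eq_cube)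
qed

lemma inv_fourier_indicator_shell:
  fixes \<omega> :: "real^3"
  assumes "0 < r" "r \<le> R"
  shows "inv_fourier (indicator (shell r R)) \<omega> =
    inv_fourier (indicator (cball 0 R)) \<omega> - inv_fourier (indicator (cball 0 r)) \<omega>"
proof -
  have int: "integrable lborel (\<lambda>x::real^3. indicator (cball 0 \<rho>) x * cis (2 * pi * (\<omega> \<bullet> x)))" for \<rho>
    by (rule Bochner_Integration.integrable_bound[OF integrable_indicator_bounded(1)[of "cball 0 \<rho>"]])
      (auto simp: norm_mult cis_conv_exp intro!: borel_measurable_times borel_measurable_indicator)
  have "indicator (shell r R) x = (indicator (cball 0 R) x - indicator (cball 0 r) x :: complex)" for x :: "real^3"
    using assms by (auto simp: shell_def indicator_def)
  then show ?thesis
    unfolding inv_fourier_def using int by (simp add: left_diff_distrib)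
qed

lemma sets_shell [measurable]: "shell r R \<in> sets borel"
  unfolding shell_def by auto

lemma bounded_shell: "bounded (shell r R)"
  unfolding shell_def by (rule bounded_subset[OF bounded_cball]) auto

lemma norm_inv_fourier_indicator_shell_le:
  fixes \<omega> :: "real^3"
  assumes "0 < r" "r \<le> R"
  shows "norm (inv_fourier (indicator (shell r R)) \<omega>) \<le> 4 / 3 * pi * (R ^ 3 - r ^ 3)"
proof -
  have "norm (inv_fourier (indicator (shell r R)) \<omega>) \<le> measure lborel (shell r R :: (real^3) set) * 1"
    unfolding inv_fourier_def
    by (rule norm_integral_indicator_mult_le[OF sets_shell bounded_shell]) (auto simp: cis_conv_exp)
  then show ?thesis
    by (simp only: measure_shell[OF assms] mult_1_right)
qed

text \<open>By Parseval's formula the integral over frequencies becomes an integral over the shell of the Gaussian with centre \<open>- v\<close>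
  (up to phases). A point \<open>x\<close> of the shell has norm within \<open>h\<close> of \<open>t\<close>, so its distance \<open>norm (v + x)\<close>
  from that centre is at least \<open>\<bar>norm v - t\<bar> - h\<close>, and this bounds the Gaussian (by 1, if the difference is negative);
 the volume of the shell is the other factor.\<close>

lemma shell_gaussian_bound:
  fixes v c :: "real^3"
  assumes "0 < t" "0 < h"
  shows "cmod (LINT \<omega>|lborel. inv_fourier (indicator (shell t (t + h))) \<omega> *
      (cis (2 * pi * (v \<bullet> \<omega>)) * complex_of_real (exp (- pi * 2 * (norm (\<omega> - c))\<^sup>2))))
    \<le> 4 / 3 * pi * ((t + h) ^ 3 - t ^ 3) * exp (- pi / 2 * (max 0 (\<bar>norm v - t\<bar> - h))\<^sup>2)"
    (is "cmod (LINT \<omega>|lborel. ?K \<omega> * ?W \<omega>) \<le> ?V * ?M")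
proof -
  let ?S = "shell t (t + h) :: (real^3) set"
  have W: "integrable lborel ?W"
    using has_bochner_integral_shifted_gaussian_cis[of 2 v c] by (simp add: has_bochner_integral_iff)
  have fW: "cnj (fourier (\<lambda>\<omega>. cnj (?W \<omega>)) x) = cis (2 * pi * ((v + x) \<bullet> c)) *
      complex_of_real (exp (- pi * (norm (v + x))\<^sup>2 / 2) / sqrt 2 ^ 3)" (is "_ = ?H x") for x
  proof -
    have "cis (2 * pi * (x \<bullet> \<omega>)) * ?W \<omega> = cis (2 * pi * ((v + x) \<bullet> \<omega>)) *
        complex_of_real (exp (- pi * 2 * (norm (\<omega> - c))\<^sup>2))" for \<omega>
      by (simp add: inner_add_left distrib_left flip: cis_mult)
    then have "cnj (fourier (\<lambda>\<omega>. cnj (?W \<omega>)) x) = (LINT \<omega>|lborel. cis (2 * pi * ((v + x) \<bullet> \<omega>)) *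
        complex_of_real (exp (- pi * 2 * (norm (\<omega> - c))\<^sup>2)))"
      unfolding fourier_def Bochner_Integration.integral_cnj[symmetric]
      by (intro Bochner_Integration.integral_cong refl) (simp add: cis_cnj inner_commute mult_ac)
    then show ?thesis
      using has_bochner_integral_shifted_gaussian_cis[of 2 "v + x" c]
      by (simp add: has_bochner_integral_iff)
  qed
  have le: "norm (?H x) \<le> ?M" if "x \<in> ?S" for x
  proof -
    have "t \<le> norm x" "norm x \<le> t + h" using that by (auto simp: shell_def)
    moreover have "norm v \<le> norm (v + x) + norm x" "norm x \<le> norm (v + x) + norm v"
      using norm_triangle_ineq4[of "v + x" x] norm_triangle_ineq4[of "v + x" v] by auto
    ultimately have "max 0 (\<bar>norm v - t\<bar> - h) \<le> norm (v + x)" using assms by auto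
    then have "(max 0 (\<bar>norm v - t\<bar> - h))\<^sup>2 \<le> (norm (v + x))\<^sup>2" by (intro power_mono) auto
    then have "exp (- pi * (norm (v + x))\<^sup>2 / 2) \<le> ?M" by simp
    \<comment> \<open>The normalisation of the Gaussian integral is a factor \<open>1 / sqrt 2 ^ 3 \<le> 1\<close>.\<close>
    moreover have "1 \<le> sqrt 2 ^ 3" by (intro one_le_power) auto
    then have "exp (- pi * (norm (v + x))\<^sup>2 / 2) / sqrt 2 ^ 3 \<le> exp (- pi * (norm (v + x))\<^sup>2 / 2)"
      by (simp add: divide_le_eq mult_le_cancel_left1)
    ultimately have "exp (- pi * (norm (v + x))\<^sup>2 / 2) / sqrt 2 ^ 3 \<le> ?M" by linarith
    then show ?thesis
      by (simp only: norm_mult norm_cis norm_of_real) simp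
  qed
  have "(LINT \<omega>|lborel. ?K \<omega> * ?W \<omega>) = L2_inner ?K (\<lambda>\<omega>. cnj (?W \<omega>))"
    by (simp only: L2_inner_def complex_cnj_cnj)
  also have "\<dots> = (LINT x|lborel. indicator ?S x * ?H x)"
    by (subst L2_inner_inv_fourier)
      (use W integrable_indicator_bounded(1)[OF sets_shell bounded_shell] in \<open>auto simp only: fW integrable_cnj\<close>)
  finally have "cmod (LINT \<omega>|lborel. ?K \<omega> * ?W \<omega>) = cmod (LINT x|lborel. indicator ?S x * ?H x)"
    by (rule arg_cong)
  also have "\<dots> \<le> measure lborel ?S * ?M"
  proof (rule norm_integral_indicator_mult_le[OF sets_shell bounded_shell _ le])
    show "?H \<in> borel_measurable borel"
      unfolding cis_conv_exp by measurable
  qed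
  also have "measure lborel ?S = ?V"
    by (rule measure_shell) (use assms in auto)
  finally show ?thesis .
qed

text \<open>The shell estimate divided by the thickness \<open>h\<close>, in the limit of vanishing thickness: on the left dominated
  convergence brings in \<open>4 * pi * t\<close> times the wave symbol, and on the right the volume of the shell over \<open>h\<close> tends
  to the area \<open>4 * pi * t\<^sup>2\<close> of the sphere.\<close>

lemma wave_symbol_gaussian_bound:
  fixes v c :: "real^3"
  assumes t: "t > 0"
  shows "cmod (LINT \<omega>|lborel. complex_of_real (wave_symbol t \<omega>) *
      (cis (2 * pi * (v \<bullet> \<omega>)) * complex_of_real (exp (- pi * 2 * (norm (\<omega> - c))\<^sup>2))))
    \<le> t * exp (- pi / 2 * (norm v - t)\<^sup>2)"
    (is "cmod (LINT \<omega>|lborel. ?m \<omega> * ?W \<omega>) \<le> _")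
proof -
  define h where "h n = inverse (real (Suc n))" for n
  have h: "h \<longlonglongrightarrow> 0" "h n > 0" "h n \<le> 1" for n
    using LIMSEQ_inverse_real_of_nat by (auto simp: h_def[abs_def] inverse_eq_divide)
  define K where "K n \<omega> = inv_fourier (indicator (shell t (t + h n))) \<omega> / complex_of_real (h n)" for n and \<omega> :: "real^3"
  have W: "integrable lborel ?W"
    using has_bochner_integral_shifted_gaussian_cis[of 2 v c] by (simp add: has_bochner_integral_iff)
  have [measurable]: "K n \<in> borel_measurable borel" for n
    unfolding K_def[abs_def] by measurable
  \<comment> \<open>The cube is expanded to make the division by \<open>h n\<close> exact, for use both in the domination and in the limit.\<close>
  have vol: "4 / 3 * pi * ((t + h n) ^ 3 - t ^ 3) / h n = 4 / 3 * pi * (3 * t\<^sup>2 + 3 * t * h n + (h n)\<^sup>2)" for n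
    using h(2)[of n] by (simp add: field_simps power2_eq_square power3_eq_cube)
  have "(\<lambda>n. LINT \<omega>|lborel. K n \<omega> * ?W \<omega>) \<longlonglongrightarrow> (LINT \<omega>|lborel. complex_of_real (4 * pi * t) * (?m \<omega> * ?W \<omega>))"
  proof (rule integral_dominated_convergence)
    show "integrable lborel (\<lambda>\<omega>. 4 / 3 * pi * (3 * t\<^sup>2 + 3 * t + 1) * norm (?W \<omega>))"
      using integrable_norm[OF W] by simp
    \<comment> \<open>The closed form of the ball transform has a removable singularity at the origin, a null set.\<close>
    show "AE \<omega> in lborel. (\<lambda>n. K n \<omega> * ?W \<omega>) \<longlonglongrightarrow> complex_of_real (4 * pi * t) * (?m \<omega> * ?W \<omega>)"
      using AE_lborel_singleton[of 0]
    proof eventually_elim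
      case (elim \<omega>)
      have "(\<lambda>n. K n \<omega> * ?W \<omega>) \<longlonglongrightarrow> complex_of_real (4 * pi * t * wave_symbol t \<omega>) * ?W \<omega>"
        using shell_transform_tendsto_wave_symbol[OF t elim h(1,2)] t h(2)
        by (intro tendsto_mult_right) (simp add: K_def inv_fourier_indicator_shell less_imp_le)
      then show ?case by (simp add: mult_ac)
    qed
    show "AE \<omega> in lborel. norm (K n \<omega> * ?W \<omega>) \<le> 4 / 3 * pi * (3 * t\<^sup>2 + 3 * t + 1) * norm (?W \<omega>)" for n
    proof (rule AE_I2)
      fix \<omega>
      have "norm (K n \<omega>) = norm (inv_fourier (indicator (shell t (t + h n))) \<omega>) / h n"
        using h(2)[of n] by (simp add: K_def norm_divide)
      also have "\<dots> \<le> 4 / 3 * pi * ((t + h n) ^ 3 - t ^ 3) / h n"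
        using t h(2)[of n]
        by (intro divide_right_mono norm_inv_fourier_indicator_shell_le) auto
      also have "\<dots> \<le> 4 / 3 * pi * (3 * t\<^sup>2 + 3 * t + 1)"
        unfolding vol using t h(2,3)[of n]
        by (intro mult_left_mono add_mono power_le_one) auto
      finally show "norm (K n \<omega> * ?W \<omega>) \<le> 4 / 3 * pi * (3 * t\<^sup>2 + 3 * t + 1) * norm (?W \<omega>)"
        unfolding norm_mult[of "K n \<omega>"] by (rule mult_right_mono) simp
    qed
  qed (use W in \<open>auto dest: borel_measurable_integrable\<close>)
  from tendsto_norm[OF this]
  have lim: "(\<lambda>n. cmod (LINT \<omega>|lborel. K n \<omega> * ?W \<omega>)) \<longlonglongrightarrow> 4 * pi * t * cmod (LINT \<omega>|lborel. ?m \<omega> * ?W \<omega>)"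
    unfolding integral_mult_right_zero norm_mult norm_of_real using t by simp
  have bnd: "cmod (LINT \<omega>|lborel. K n \<omega> * ?W \<omega>) \<le> 4 / 3 * pi * (3 * t\<^sup>2 + 3 * t * h n + (h n)\<^sup>2) *
      exp (- pi / 2 * (max 0 (\<bar>norm v - t\<bar> - h n))\<^sup>2)" for n
  proof -
    have "(LINT \<omega>|lborel. K n \<omega> * ?W \<omega>) =
      (LINT \<omega>|lborel. inv_fourier (indicator (shell t (t + h n))) \<omega> * ?W \<omega>) / complex_of_real (h n)"
      by (simp add: K_def)
    then have "cmod (LINT \<omega>|lborel. K n \<omega> * ?W \<omega>) =
      cmod (LINT \<omega>|lborel. inv_fourier (indicator (shell t (t + h n))) \<omega> * ?W \<omega>) / h n"
      using h(2)[of n] by (simp only: norm_divide norm_of_real abs_of_pos)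
    also have "\<dots> \<le> 4 / 3 * pi * ((t + h n) ^ 3 - t ^ 3) * exp (- pi / 2 * (max 0 (\<bar>norm v - t\<bar> - h n))\<^sup>2) / h n"
      using h(2)[of n] by (intro divide_right_mono shell_gaussian_bound t) auto
    also have "\<dots> = (4 / 3 * pi * ((t + h n) ^ 3 - t ^ 3) / h n) * exp (- pi / 2 * (max 0 (\<bar>norm v - t\<bar> - h n))\<^sup>2)"
      by (rule times_divide_eq_left[symmetric])
    finally show ?thesis unfolding vol .
  qed
  have "(\<lambda>n. 4 / 3 * pi * (3 * t\<^sup>2 + 3 * t * h n + (h n)\<^sup>2) * exp (- pi / 2 * (max 0 (\<bar>norm v - t\<bar> - h n))\<^sup>2))
     \<longlonglongrightarrow> 4 / 3 * pi * (3 * t\<^sup>2 + 3 * t * 0 + 0\<^sup>2) * exp (- pi / 2 * (max 0 (\<bar>norm v - t\<bar> - 0))\<^sup>2)"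
    by (intro tendsto_intros h(1))
  from LIMSEQ_le[OF lim this] bnd
  have "4 * pi * t * cmod (LINT \<omega>|lborel. ?m \<omega> * ?W \<omega>) \<le>
      4 / 3 * pi * (3 * t\<^sup>2 + 3 * t * 0 + 0\<^sup>2) * exp (- pi / 2 * (max 0 (\<bar>norm v - t\<bar> - 0))\<^sup>2)"
    by blast
  also have "\<dots> = 4 * pi * t * (t * exp (- pi / 2 * (norm v - t)\<^sup>2))"
    by (simp add: power2_eq_square)
  finally show ?thesis
    by (rule mult_left_le_imp_le) (use t in simp)
qed

section \<open>The matrix coefficients of the wave propagator\<close>

theorem proposition6p7:
  fixes t :: real and x \<xi> y \<eta> :: "real ^ 3"
  assumes "t > 0"
  shows "cmod (L2_inner (wave_propagator t (tf_shift (x, \<xi>) gaussian)) (tf_shift (y, \<eta>) gaussian))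
    \<le> t * exp (- pi / 2 * (norm (x - y) - t)\<^sup>2) * exp (- pi / 2 * (norm (\<xi> - \<eta>))\<^sup>2)"
proof -
  define c where "c = (1 / 2) *\<^sub>R (\<xi> + \<eta>)"
  define E where "E = exp (- pi / 2 * (norm (\<xi> - \<eta>))\<^sup>2)"
  let ?m = "\<lambda>\<omega>::real^3. complex_of_real (wave_symbol t \<omega>)"
  let ?W = "\<lambda>\<omega>. cis (2 * pi * ((y - x) \<bullet> \<omega>)) * complex_of_real (exp (- pi * 2 * (norm (\<omega> - c))\<^sup>2))"
  have gauss: "integrable lborel (\<lambda>u. gaussian (u - x))" for x :: "real^3"
    using has_bochner_integral_shifted_gaussian_cis[of 1 0 x]
    by (simp add: has_bochner_integral_iff gaussian_def)
  have [measurable]: "(gaussian :: real^3 \<Rightarrow> complex) \<in> borel_measurable borel"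
    unfolding gaussian_def[abs_def] by measurable
  have f: "integrable lborel (tf_shift (y, \<eta>) gaussian)"
    by (rule Bochner_Integration.integrable_bound[OF gauss[of y]])
      (auto simp: tf_shift_def norm_mult cis_conv_exp)
  have g: "integrable lborel (\<lambda>\<omega>. ?m \<omega> * fourier (tf_shift (x, \<xi>) gaussian) \<omega>)"
  proof (rule Bochner_Integration.integrable_bound)
    show "integrable lborel (\<lambda>\<omega>. complex_of_real t * gaussian (\<omega> - \<xi>))"
      using gauss by simp
    show "AE \<omega> in lborel. norm (?m \<omega> * fourier (tf_shift (x, \<xi>) gaussian) \<omega>)
        \<le> norm (complex_of_real t * gaussian (\<omega> - \<xi>))"
      using assms abs_wave_symbol_le[OF assms]
      by (intro AE_I2) (auto simp: fourier_tf_shift_gaussian norm_mult intro!: mult_right_mono)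
  qed (auto simp: fourier_tf_shift_gaussian cis_conv_exp)
  have gg: "gaussian (\<omega> - \<xi>) * gaussian (\<omega> - \<eta>) = complex_of_real (exp (- pi * 2 * (norm (\<omega> - c))\<^sup>2) * E)" for \<omega>
  proof -
    \<comment> \<open>The parallelogram law at the midpoint \<open>c\<close> of \<open>\<xi>\<close> and \<open>\<eta>\<close> splits off the decay in \<open>\<xi> - \<eta>\<close>.\<close>
    have "(norm (\<omega> - \<xi>))\<^sup>2 + (norm (\<omega> - \<eta>))\<^sup>2 = 2 * (norm (\<omega> - c))\<^sup>2 + (norm (\<xi> - \<eta>))\<^sup>2 / 2"
      unfolding c_def power2_norm_eq_inner
      by (simp add: inner_diff_left inner_diff_right inner_add_left inner_add_right inner_commute field_simps)
    then have "- pi * (norm (\<omega> - \<xi>))\<^sup>2 + - pi * (norm (\<omega> - \<eta>))\<^sup>2 =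
        - pi * 2 * (norm (\<omega> - c))\<^sup>2 + - pi / 2 * (norm (\<xi> - \<eta>))\<^sup>2"
      by (simp add: algebra_simps flip: distrib_left)
    then show ?thesis
      unfolding gaussian_def E_def of_real_mult[symmetric] exp_add[symmetric] by simp
  qed
  have "L2_inner (wave_propagator t (tf_shift (x, \<xi>) gaussian)) (tf_shift (y, \<eta>) gaussian) =
      (LINT \<omega>|lborel. ?m \<omega> * fourier (tf_shift (x, \<xi>) gaussian) \<omega> * cnj (fourier (tf_shift (y, \<eta>) gaussian) \<omega>))"
    unfolding wave_propagator_def fourier_multiplier_def by (rule L2_inner_inv_fourier[OF g f])
  also have "\<dots> = (LINT \<omega>|lborel. (complex_of_real E * cis (2 * pi * (x \<bullet> \<xi> - y \<bullet> \<eta>))) * (?m \<omega> * ?W \<omega>))"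
  proof (intro Bochner_Integration.integral_cong refl)
    fix \<omega>
    have ph: "cis (2 * pi * (x \<bullet> (\<xi> - \<omega>))) * cnj (cis (2 * pi * (y \<bullet> (\<eta> - \<omega>)))) =
        cis (2 * pi * (x \<bullet> \<xi> - y \<bullet> \<eta>)) * cis (2 * pi * ((y - x) \<bullet> \<omega>))"
      unfolding cis_cnj cis_mult by (rule arg_cong[of _ _ cis]) (simp add: algebra_simps)
    have "?m \<omega> * fourier (tf_shift (x, \<xi>) gaussian) \<omega> * cnj (fourier (tf_shift (y, \<eta>) gaussian) \<omega>) =
        ?m \<omega> * (cis (2 * pi * (x \<bullet> (\<xi> - \<omega>))) * cnj (cis (2 * pi * (y \<bullet> (\<eta> - \<omega>))))) *
        (gaussian (\<omega> - \<xi>) * gaussian (\<omega> - \<eta>))"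
      unfolding fourier_tf_shift_gaussian by (simp add: gaussian_def mult_ac)
    then show "?m \<omega> * fourier (tf_shift (x, \<xi>) gaussian) \<omega> * cnj (fourier (tf_shift (y, \<eta>) gaussian) \<omega>) =
        (complex_of_real E * cis (2 * pi * (x \<bullet> \<xi> - y \<bullet> \<eta>))) * (?m \<omega> * ?W \<omega>)"
      unfolding ph gg by (simp add: mult_ac)
  qed
  finally have "cmod (L2_inner (wave_propagator t (tf_shift (x, \<xi>) gaussian)) (tf_shift (y, \<eta>) gaussian)) =
      E * cmod (LINT \<omega>|lborel. ?m \<omega> * ?W \<omega>)"
    by (simp only: integral_mult_right_zero norm_mult norm_of_real norm_cis) (simp add: E_def)
  also have "\<dots> \<le> E * (t * exp (- pi / 2 * (norm (y - x) - t)\<^sup>2))"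
    by (rule mult_left_mono[OF wave_symbol_gaussian_bound[OF assms]]) (simp add: E_def)
  finally show ?thesis
    unfolding E_def norm_minus_commute[of y x] by (simp only: mult_ac)
qed

end
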